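(* Let $L$ be a bounded distributive lattice with Priestley space $X$. There is a map $\Pi:P(L^{\Diamond\Box})\to\mathcal{C}$ from the Priestley space of $L^{\Diamond\Box}$ to the set $\mathcal{C}$ of convex closed sets of the Priestley space of $L$, with the Egli-Milner order and weak hit-or-miss topology, given by \[ \Pi(G)=\bigcap\{a^+\mid \Box_a\in G\}\cap\bigcap\{a^-\mid\Diamond_a\notin G\}. \] This map is an order-homeomorphism and for each $a\in L$ we have $\Pi(\Box_a^+)=\Box_{a^-}$, $\Pi(\Box_a^-)=\Diamond_{a^-}$, $\Pi(\Diamond_a^+)=\Diamond_{a^+}$ and $\Pi(\Diamond_a^-)=\Box_{a^+}$.
   Context: For a bounded distributive lattice $D$, its Priestley space $P(D)$ is the set of (proper) prime filters of $D$ ordered by inclusion, with the topology generated by the sets $d^+=\{G\in P(D)\mid d\in G\}$ and $d^-=\{G\in P(D)\mid d\notin G\}$, $d\in D$. Thus for $a\in L$, $a^+,a^-\subseteq X=P(L)$, while $\Box_a^+=(\Box_a)^+$, $\Box_a^-=(\Box_a)^-$, $\Diamond_a^+=(\Diamond_a)^+$, $\Diamond_a^-=(\Diamond_a)^-$ are subsets of $P(L^{\Diamond\Box})$. $L^{\Diamond\Box}$ is the bounded distributive lattice freely generated by the set of symbols $\Diamond_a,\Box_a$ for $a\in L$ modulo the relations (for all $a,b\in L$): $\Diamond_0=0$, $\Diamond_a\vee\Diamond_b=\Diamond_{a\vee b}$, $\Box_1=1$, $\Box_a\wedge\Box_b=\Box_{a\wedge b}$, $\Box_{a\vee b}\le\Box_a\vee\Diamond_b$,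 and $\Box_a\wedge\Diamond_b\le\Diamond_{a\wedge b}$. $\mathcal{C}$ is the set of closed subsets $C$ of $X$ (including $\varnothing$) that are convex ($x,y\in C$ and $x\le z\le y$ imply $z\in C$), partially ordered by the Egli-Milner order: $A\sqsubseteq B$ iff $A\subseteq{\downarrow}B$ and $B\subseteq{\uparrow}A$. For $S\in\{a^+,a^-\}$, as subsets of $\mathcal{C}$, $\Diamond_S=\{C\in\mathcal{C}\mid C\cap S\neq\varnothing\}$ and $\Box_S=\{C\in\mathcal{C}\mid C\cap S=\varnothing\}$. The weak hit-or-miss topology on $\mathcal{C}$ is generated by the sets $\Box_{a^+},\Box_{a^-},\Diamond_{a^+},\Diamond_{a^-}$ for $a\in L$. An order-homeomorphism is a homeomorphism that is an order-isomorphism. *)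

theory Defs
  imports "HOL-Analysis.Analysis"
begin

section \<open>Priestley spaces of bounded distributive lattices\<close>

text \<open>
  A bounded distributive lattice is a type of sort \<open>{bounded_lattice, distrib_lattice}\<close>.  This
  does not exclude \<open>bot = top\<close>; the one-element lattice has no prime filters.
\<close>

definition prime_filter :: "'d::{bounded_lattice,distrib_lattice} set \<Rightarrow> bool" where
  "prime_filter G \<longleftrightarrow>
     top \<in> G \<and> (\<forall>x y. x \<in> G \<longrightarrow> x \<le> y \<longrightarrow> y \<in> G) \<and> (\<forall>x\<in>G. \<forall>y\<in>G. inf x y \<in> G) \<and>
     bot \<notin> G \<and> (\<forall>x y. sup x y \<in> G \<longrightarrow> x \<in> G \<or> y \<in> G)"

definition priestley :: "'d::{bounded_lattice,distrib_lattice} set set" where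
  "priestley = {G. prime_filter G}"

definition ppos :: "'d::{bounded_lattice,distrib_lattice} \<Rightarrow> 'd set set" where
  "ppos d = {G \<in> priestley. d \<in> G}"

definition pneg :: "'d::{bounded_lattice,distrib_lattice} \<Rightarrow> 'd set set" where
  "pneg d = {G \<in> priestley. d \<notin> G}"

definition priestley_topology :: "'d::{bounded_lattice,distrib_lattice} set topology" where
  "priestley_topology = topology_generated_by (range ppos \<union> range pneg)"

lemma topspace_priestley_topology: "topspace priestley_topology = priestley"
  by (auto simp: priestley_topology_def ppos_def pneg_def)


section \<open>The lattice freely generated by boxes and diamonds\<close>

datatype 'a vterm =
    VBox 'a | VDia 'a | VBot | VTop
  | VInf "'a vterm" "'a vterm" | VSup "'a vterm" "'a vterm"

text \<open>
  The least congruence on terms that contains the equational axioms of bounded distributive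
  lattices and the given relations; an inequality \<open>s \<le> t\<close> is written as \<open>s \<sqinter> t = s\<close>.
\<close>

inductive veq ::
  "'a::{bounded_lattice,distrib_lattice} vterm \<Rightarrow> 'a vterm \<Rightarrow> bool" (infix "\<doteq>" 50) where
  refl: "s \<doteq> s"
| sym: "s \<doteq> t \<Longrightarrow> t \<doteq> s"
| trans: "s \<doteq> t \<Longrightarrow> t \<doteq> u \<Longrightarrow> s \<doteq> u"
| cong_inf: "s \<doteq> s' \<Longrightarrow> t \<doteq> t' \<Longrightarrow> VInf s t \<doteq> VInf s' t'"
| cong_sup: "s \<doteq> s' \<Longrightarrow> t \<doteq> t' \<Longrightarrow> VSup s t \<doteq> VSup s' t'"
| inf_commute: "VInf s t \<doteq> VInf t s"
| sup_commute: "VSup s t \<doteq> VSup t s"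
| inf_assoc: "VInf (VInf s t) u \<doteq> VInf s (VInf t u)"
| sup_assoc: "VSup (VSup s t) u \<doteq> VSup s (VSup t u)"
| inf_absorb: "VInf s (VSup s t) \<doteq> s"
| sup_absorb: "VSup s (VInf s t) \<doteq> s"
| sup_distrib: "VSup s (VInf t u) \<doteq> VInf (VSup s t) (VSup s u)"
| inf_bot: "VInf VBot s \<doteq> VBot"
| inf_top: "VInf VTop s \<doteq> s"
| dia_bot: "VDia bot \<doteq> VBot"
| dia_sup: "VSup (VDia a) (VDia b) \<doteq> VDia (sup a b)"
| box_top: "VBox top \<doteq> VTop"
| box_inf: "VInf (VBox a) (VBox b) \<doteq> VBox (inf a b)"
| box_sup: "VInf (VBox (sup a b)) (VSup (VBox a) (VDia b)) \<doteq> VBox (sup a b)"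
| box_dia: "VInf (VInf (VBox a) (VDia b)) (VDia (inf a b)) \<doteq> VInf (VBox a) (VDia b)"

lemma equivp_veq: "equivp veq"
  by (intro equivpI reflpI sympI transpI) (blast intro: veq.refl veq.sym veq.trans)+

quotient_type (overloaded) 'a vlat = "'a::{bounded_lattice,distrib_lattice} vterm" / veq
  by (rule equivp_veq)

instantiation vlat :: ("{bounded_lattice,distrib_lattice}") "{bounded_lattice,distrib_lattice}"
begin

lift_definition inf_vlat :: "'a vlat \<Rightarrow> 'a vlat \<Rightarrow> 'a vlat" is VInf by (rule veq.cong_inf)
lift_definition sup_vlat :: "'a vlat \<Rightarrow> 'a vlat \<Rightarrow> 'a vlat" is VSup by (rule veq.cong_sup)
lift_definition bot_vlat :: "'a vlat" is VBot .
lift_definition top_vlat :: "'a vlat" is VTop .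

definition less_eq_vlat :: "'a vlat \<Rightarrow> 'a vlat \<Rightarrow> bool" where
  "less_eq_vlat x y \<longleftrightarrow> inf x y = x"

definition less_vlat :: "'a vlat \<Rightarrow> 'a vlat \<Rightarrow> bool" where
  "less_vlat x y \<longleftrightarrow> x \<le> y \<and> x \<noteq> y"

instance
proof
  have com_i: "inf x y = inf y x" for x y :: "'a vlat"
    by transfer (rule veq.inf_commute)
  have com_s: "sup x y = sup y x" for x y :: "'a vlat"
    by transfer (rule veq.sup_commute)
  have as_i: "inf (inf x y) z = inf x (inf y z)" for x y z :: "'a vlat"
    by transfer (rule veq.inf_assoc)
  have as_s: "sup (sup x y) z = sup x (sup y z)" for x y z :: "'a vlat"
    by transfer (rule veq.sup_assoc)
  have ab_i: "inf x (sup x y) = x" for x y :: "'a vlat"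
    by transfer (rule veq.inf_absorb)
  have ab_s: "sup x (inf x y) = x" for x y :: "'a vlat"
    by transfer (rule veq.sup_absorb)
  have id_i: "inf x x = x" for x :: "'a vlat" by (metis ab_i ab_s)
  have le_sup: "x \<le> y \<longleftrightarrow> sup x y = y" for x y :: "'a vlat"
    unfolding less_eq_vlat_def by (metis ab_i ab_s com_i com_s)
  fix x y z :: "'a vlat"
  show "(x < y) = (x \<le> y \<and> \<not> y \<le> x)"
    unfolding less_vlat_def less_eq_vlat_def by (metis com_i id_i)
  show "x \<le> x" by (simp add: less_eq_vlat_def id_i)
  show "x \<le> y \<Longrightarrow> y \<le> z \<Longrightarrow> x \<le> z" unfolding less_eq_vlat_def by (metis as_i)
  show "x \<le> y \<Longrightarrow> y \<le> x \<Longrightarrow> x = y" unfolding less_eq_vlat_def by (metis com_i)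
  show "inf x y \<le> x" unfolding less_eq_vlat_def by (metis as_i com_i id_i)
  show "inf x y \<le> y" unfolding less_eq_vlat_def by (metis as_i id_i)
  show "x \<le> y \<Longrightarrow> x \<le> z \<Longrightarrow> x \<le> inf y z" unfolding less_eq_vlat_def by (metis as_i)
  show "x \<le> sup x y" by (simp add: less_eq_vlat_def ab_i)
  show "y \<le> sup x y" by (metis less_eq_vlat_def ab_i com_s)
  show "y \<le> x \<Longrightarrow> z \<le> x \<Longrightarrow> sup y z \<le> x" unfolding le_sup by (metis as_s)
  show "bot \<le> x" unfolding less_eq_vlat_def by transfer (rule veq.inf_bot)
  have "inf top x = x" by transfer (rule veq.inf_top)
  then show "x \<le> top" by (simp add: less_eq_vlat_def com_i)
  show "sup x (inf y z) = inf (sup x y) (sup x z)" by transfer (rule veq.sup_distrib)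
qed

end

lift_definition vbox :: "'a::{bounded_lattice,distrib_lattice} \<Rightarrow> 'a vlat" is VBox .
lift_definition vdia :: "'a::{bounded_lattice,distrib_lattice} \<Rightarrow> 'a vlat" is VDia .

definition vrelations ::
  "('a::{bounded_lattice,distrib_lattice} \<Rightarrow> 'd::{bounded_lattice,distrib_lattice})
     \<Rightarrow> ('a \<Rightarrow> 'd) \<Rightarrow> bool" where
  "vrelations B D \<longleftrightarrow>
     D bot = bot \<and> (\<forall>a b. sup (D a) (D b) = D (sup a b)) \<and>
     B top = top \<and> (\<forall>a b. inf (B a) (B b) = B (inf a b)) \<and>
     (\<forall>a b. B (sup a b) \<le> sup (B a) (D b)) \<and>
     (\<forall>a b. inf (B a) (D b) \<le> D (inf a b))"

definition lattice_hom ::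
  "('c::{bounded_lattice,distrib_lattice} \<Rightarrow> 'd::{bounded_lattice,distrib_lattice}) \<Rightarrow> bool" where
  "lattice_hom h \<longleftrightarrow> h bot = bot \<and> h top = top \<and>
     (\<forall>x y. h (inf x y) = inf (h x) (h y)) \<and> (\<forall>x y. h (sup x y) = sup (h x) (h y))"

text \<open>
  The next two facts are the universal property that characterizes \<open>'a vlat\<close> with \<open>vbox\<close>
  and \<open>vdia\<close> up to isomorphism.
\<close>

lemma vrelations_vbox_vdia: "vrelations vbox vdia"
  unfolding vrelations_def less_eq_vlat_def
  by (intro conjI allI; transfer;
      rule veq.dia_bot veq.dia_sup veq.box_top veq.box_inf veq.box_sup veq.box_dia)

primrec veval :: "('a \<Rightarrow> 'd) \<Rightarrow> ('a \<Rightarrow> 'd) \<Rightarrow> 'a vterm \<Rightarrow> 'd::{bounded_lattice,distrib_lattice}" where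
  "veval B D (VBox a) = B a"
| "veval B D (VDia a) = D a"
| "veval B D VBot = bot"
| "veval B D VTop = top"
| "veval B D (VInf s t) = inf (veval B D s) (veval B D t)"
| "veval B D (VSup s t) = sup (veval B D s) (veval B D t)"

lemma veval_cong: "s \<doteq> t \<Longrightarrow> vrelations B D \<Longrightarrow> veval B D s = veval B D t"
proof (induction rule: veq.induct)
  case (box_dia a b)
  then show ?case by (simp add: vrelations_def inf.absorb1)
qed (auto simp: vrelations_def ac_simps sup_inf_distrib1 inf.absorb1)

lemma vlat_universal:
  assumes "vrelations B D"
  shows "\<exists>!h. lattice_hom h \<and> (\<forall>a. h (vbox a) = B a) \<and> (\<forall>a. h (vdia a) = D a)"
proof (rule ex1I)
  define h where "h x = veval B D (rep_vlat x)" for x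
  have h: "h (abs_vlat t) = veval B D t" for t
    unfolding h_def
    by (rule veval_cong[OF _ assms]) (metis Quotient3_vlat rep_abs_rsp_left veq.refl)
  show "lattice_hom h \<and> (\<forall>a. h (vbox a) = B a) \<and> (\<forall>a. h (vdia a) = D a)"
  proof -
    have "h (inf x y) = inf (h x) (h y) \<and> h (sup x y) = sup (h x) (h y)" for x y
      by (induct x rule: vlat.abs_induct, induct y rule: vlat.abs_induct)
         (simp add: inf_vlat.abs_eq sup_vlat.abs_eq h)
    then show ?thesis
      by (simp add: lattice_hom_def vbox.abs_eq vdia.abs_eq bot_vlat.abs_eq top_vlat.abs_eq h)
  qed
  fix g
  assume g: "lattice_hom g \<and> (\<forall>a. g (vbox a) = B a) \<and> (\<forall>a. g (vdia a) = D a)"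
  have "g (abs_vlat t) = veval B D t" for t
    using g by (induction t)
      (auto simp: lattice_hom_def vbox.abs_eq vdia.abs_eq bot_vlat_def top_vlat_def
        simp flip: inf_vlat.abs_eq sup_vlat.abs_eq)
  then have "g x = h x" for x
    by (induct x rule: vlat.abs_induct) (simp add: h)
  then show "g = h" by blast
qed


section \<open>Convex closed sets\<close>

definition down_closure :: "'a::{bounded_lattice,distrib_lattice} set set \<Rightarrow> 'a set set" where
  "down_closure A = {x \<in> priestley. \<exists>y\<in>A. x \<subseteq> y}"

definition up_closure :: "'a::{bounded_lattice,distrib_lattice} set set \<Rightarrow> 'a set set" where
  "up_closure A = {x \<in> priestley. \<exists>y\<in>A. y \<subseteq> x}"

definition convex_closed :: "'a::{bounded_lattice,distrib_lattice} set set set" where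
  "convex_closed = {C. closedin priestley_topology C \<and>
     (\<forall>x\<in>C. \<forall>y\<in>C. \<forall>z\<in>priestley. x \<subseteq> z \<longrightarrow> z \<subseteq> y \<longrightarrow> z \<in> C)}"

definition egli_milner ::
  "'a::{bounded_lattice,distrib_lattice} set set \<Rightarrow> 'a set set \<Rightarrow> bool" where
  "egli_milner A B \<longleftrightarrow> A \<subseteq> down_closure B \<and> B \<subseteq> up_closure A"

text \<open>Following the source, \<open>miss S\<close> (written with a box there) consists of the sets that are
  disjoint from \<open>S\<close>, not of those that are contained in \<open>S\<close>.\<close>

definition hit :: "'a::{bounded_lattice,distrib_lattice} set set \<Rightarrow> 'a set set set" where
  "hit S = {C \<in> convex_closed. C \<inter> S \<noteq> {}}"

definition miss :: "'a::{bounded_lattice,distrib_lattice} set set \<Rightarrow> 'a set set set" where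
  "miss S = {C \<in> convex_closed. C \<inter> S = {}}"

definition hit_or_miss_topology ::
  "'a::{bounded_lattice,distrib_lattice} set set topology" where
  "hit_or_miss_topology = topology_generated_by
     (range (\<lambda>a. miss (ppos a)) \<union> range (\<lambda>a. miss (pneg a)) \<union>
      range (\<lambda>a. hit (ppos a)) \<union> range (\<lambda>a. hit (pneg a)))"

lemma topspace_hit_or_miss_topology: "topspace hit_or_miss_topology = convex_closed"
  by (auto simp: hit_or_miss_topology_def hit_def miss_def)

text \<open>For \<open>G \<in> priestley\<close> neither family of sets is empty, since \<open>vbox top \<in> G\<close> and
  \<open>vdia bot \<notin> G\<close>; so the intersections are subsets of \<open>priestley\<close>.\<close>

definition Pi_map :: "'a::{bounded_lattice,distrib_lattice} vlat set \<Rightarrow> 'a set set" where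
  "Pi_map G = \<Inter>{ppos a |a. vbox a \<in> G} \<inter> \<Inter>{pneg a |a. vdia a \<notin> G}"

end

theory Submission
  imports Defs
begin

text \<open>
  For a prime filter \<open>G\<close> of \<open>'a vlat\<close>, the elements \<open>a\<close> with \<open>vbox a \<in> G\<close> form a filter, those with
  \<open>vdia a \<notin> G\<close> form an ideal, and \<open>Pi_map G\<close> consists of the prime filters that extend the former
  and avoid the latter. The two mixed relations are what the prime filter theorem needs to produce
  enough points in \<open>Pi_map G\<close>: \<open>vbox a \<in> G\<close> iff all its points contain \<open>a\<close>, and \<open>vdia a \<in> G\<close> iff some
  point does. The same separation argument, applied to a given prime filter instead of a
  principal filter or ideal, shows that inclusion corresponds to the Egli-Milner order.
  Conversely, a convex closed set \<open>C\<close> defines by these two conditions a homomorphism from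
  \<open>'a vlat\<close> to \<open>bool\<close>, and the resulting set of prime filters is \<open>C\<close> again: by compactness,
  each of its points lies between two points of \<open>C\<close>.
\<close>

section \<open>Prime filter separation\<close>

text \<open>Improper filters are allowed, and likewise improper ideals below:
  \<open>{a. vbox a \<in> G}\<close> is the whole lattice when \<open>Pi_map G\<close> is
  empty.\<close>

definition lattice_filter :: "'d::bounded_lattice set \<Rightarrow> bool" where
  "lattice_filter F \<longleftrightarrow>
     top \<in> F \<and> (\<forall>x y. x \<in> F \<longrightarrow> x \<le> y \<longrightarrow> y \<in> F) \<and> (\<forall>x\<in>F. \<forall>y\<in>F. inf x y \<in> F)"

definition lattice_ideal :: "'d::bounded_lattice set \<Rightarrow> bool" where
  "lattice_ideal I \<longleftrightarrow>
     bot \<in> I \<and> (\<forall>x y. y \<in> I \<longrightarrow> x \<le> y \<longrightarrow> x \<in> I) \<and> (\<forall>x\<in>I. \<forall>y\<in>I. sup x y \<in> I)"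

section \<open>Elementary rules for filters, ideals and prime filters\<close>

lemma lattice_filter_inf_iff: "lattice_filter F \<Longrightarrow> inf x y \<in> F \<longleftrightarrow> x \<in> F \<and> y \<in> F"
  unfolding lattice_filter_def by (meson inf_le1 inf_le2)

lemma lattice_ideal_sup_iff: "lattice_ideal I \<Longrightarrow> sup x y \<in> I \<longleftrightarrow> x \<in> I \<and> y \<in> I"
  unfolding lattice_ideal_def by (meson sup_ge1 sup_ge2)

lemma lattice_filter_atLeast: "lattice_filter {a..}"
  by (auto simp: lattice_filter_def)

lemma lattice_ideal_atMost: "lattice_ideal {..a}"
  by (auto simp: lattice_ideal_def)

lemma prime_filter_imp_filter: "prime_filter P \<Longrightarrow> lattice_filter P"
  by (auto simp: prime_filter_def lattice_filter_def)

lemma prime_filter_mono: "prime_filter P \<Longrightarrow> x \<in> P \<Longrightarrow> x \<le> y \<Longrightarrow> y \<in> P"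
  by (auto simp: prime_filter_def)

lemma prime_filter_inf_iff: "prime_filter P \<Longrightarrow> inf x y \<in> P \<longleftrightarrow> x \<in> P \<and> y \<in> P"
  by (simp add: lattice_filter_inf_iff prime_filter_imp_filter)

lemma prime_filter_sup_iff: "prime_filter P \<Longrightarrow> sup x y \<in> P \<longleftrightarrow> x \<in> P \<or> y \<in> P"
  unfolding prime_filter_def by (meson sup_ge1 sup_ge2)

lemma prime_filter_top: "prime_filter P \<Longrightarrow> top \<in> P"
  and prime_filter_bot: "prime_filter P \<Longrightarrow> bot \<notin> P"
  by (auto simp: prime_filter_def)

lemma prime_filter_imp_ideal: "prime_filter P \<Longrightarrow> lattice_ideal (- P)"
  unfolding lattice_ideal_def
  by (auto simp: prime_filter_bot prime_filter_sup_iff dest: prime_filter_mono)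

text \<open>This is the filter generated by \<open>F \<union> E\<close>. The explicit formula makes
  membership exhibit one element of each filter.\<close>

lemma lattice_filter_join:
  fixes F E :: "'d::{bounded_lattice,distrib_lattice} set"
  assumes F: "lattice_filter F" and E: "lattice_filter E"
  shows "lattice_filter {x. \<exists>f\<in>F. \<exists>e\<in>E. inf f e \<le> x}"
  unfolding lattice_filter_def mem_Collect_eq
proof (intro conjI allI impI ballI)
  show "\<exists>f\<in>F. \<exists>e\<in>E. inf f e \<le> top"
    using F E by (auto simp: lattice_filter_def)
  show "\<exists>f\<in>F. \<exists>e\<in>E. inf f e \<le> y" if "\<exists>f\<in>F. \<exists>e\<in>E. inf f e \<le> x" "x \<le> y" for x y
    using that by (blast intro: order_trans)
  fix x y
  assume "x \<in> {x. \<exists>f\<in>F. \<exists>e\<in>E. inf f e \<le> x}" "y \<in> {x. \<exists>f\<in>F. \<exists>e\<in>E. inf f e \<le> x}"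
  then obtain f e f' e' where mem: "f \<in> F" "e \<in> E" "f' \<in> F" "e' \<in> E"
    and le: "inf f e \<le> x" "inf f' e' \<le> y" by blast
  have "inf (inf f f') (inf e e') = inf (inf f e) (inf f' e')"
    by (simp add: ac_simps)
  also have "\<dots> \<le> inf x y" using le by (rule inf_mono)
  finally show "\<exists>f\<in>F. \<exists>e\<in>E. inf f e \<le> inf x y"
    using mem F E by (meson lattice_filter_inf_iff)
qed

lemma lattice_ideal_join:
  fixes I J :: "'d::{bounded_lattice,distrib_lattice} set"
  assumes I: "lattice_ideal I" and J: "lattice_ideal J"
  shows "lattice_ideal {x. \<exists>i\<in>I. \<exists>j\<in>J. x \<le> sup i j}"
  unfolding lattice_ideal_def mem_Collect_eq
proof (intro conjI allI impI ballI)
  show "\<exists>i\<in>I. \<exists>j\<in>J. bot \<le> sup i j"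
    using I J by (auto simp: lattice_ideal_def)
  show "\<exists>i\<in>I. \<exists>j\<in>J. x \<le> sup i j" if "\<exists>i\<in>I. \<exists>j\<in>J. y \<le> sup i j" "x \<le> y" for x y
    using that by (blast intro: order_trans)
  fix x y
  assume "x \<in> {x. \<exists>i\<in>I. \<exists>j\<in>J. x \<le> sup i j}" "y \<in> {x. \<exists>i\<in>I. \<exists>j\<in>J. x \<le> sup i j}"
  then obtain i j i' j' where mem: "i \<in> I" "j \<in> J" "i' \<in> I" "j' \<in> J"
    and le: "x \<le> sup i j" "y \<le> sup i' j'" by blast
  have "sup x y \<le> sup (sup i j) (sup i' j')" using le by (rule sup_mono)
  also have "\<dots> = sup (sup i i') (sup j j')"
    by (simp add: ac_simps)
  finally show "\<exists>i\<in>I. \<exists>j\<in>J. sup x y \<le> sup i j"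
    using mem I J by (meson lattice_ideal_sup_iff)
qed

text \<open>Zorn's lemma gives a filter that is maximal among those containing \<open>F\<close> and
  disjoint from \<open>I\<close>. Maximality and distributivity together force it to be
  prime.\<close>

lemma prime_filter_theorem:
  fixes F I :: "'d::{bounded_lattice,distrib_lattice} set"
  assumes F: "lattice_filter F" and I: "lattice_ideal I" and disj: "F \<inter> I = {}"
  obtains P where "prime_filter P" "F \<subseteq> P" "P \<inter> I = {}"
proof -
  define \<A> where "\<A> = {P. lattice_filter P \<and> F \<subseteq> P \<and> P \<inter> I = {}}"
  have "\<exists>M\<in>\<A>. \<forall>X\<in>\<A>. M \<subseteq> X \<longrightarrow> X = M"
  proof (rule subset_Zorn_nonempty)
    show "\<A> \<noteq> {}" using assms by (auto simp: \<A>_def)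
    fix \<C> assume "\<C> \<noteq> {}" and ch: "subset.chain \<A> \<C>"
    have sub: "\<And>P. P \<in> \<C> \<Longrightarrow> lattice_filter P \<and> F \<subseteq> P \<and> P \<inter> I = {}"
      using ch by (auto simp: subset.chain_def \<A>_def)
    have "inf x y \<in> \<Union>\<C>" if "P \<in> \<C>" "Q \<in> \<C>" "x \<in> P" "y \<in> Q" for x y P Q
    proof -
      have "P \<subseteq> Q \<or> Q \<subseteq> P" using ch that by (auto simp: subset.chain_def)
      then show ?thesis
        using that sub by (metis UnionI lattice_filter_inf_iff subsetD)
    qed
    moreover have "top \<in> \<Union>\<C>"
      using \<open>\<C> \<noteq> {}\<close> sub by (auto simp: lattice_filter_def)
    moreover have "y \<in> \<Union>\<C>" if "x \<in> \<Union>\<C>" "x \<le> y" for x y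
      using that sub unfolding lattice_filter_def by (meson UnionE UnionI)
    ultimately have "lattice_filter (\<Union>\<C>)" by (auto simp: lattice_filter_def)
    then show "\<Union>\<C> \<in> \<A>" using sub \<open>\<C> \<noteq> {}\<close> unfolding \<A>_def by fast
  qed
  then obtain M where M: "lattice_filter M" "F \<subseteq> M" "M \<inter> I = {}"
    and max: "\<And>X. lattice_filter X \<Longrightarrow> F \<subseteq> X \<Longrightarrow> X \<inter> I = {} \<Longrightarrow> M \<subseteq> X \<Longrightarrow> X = M"
    unfolding \<A>_def by auto
  \<comment> \<open>Otherwise the filter generated by \<open>M\<close> and \<open>a\<close> would
    still be disjoint from \<open>I\<close>, against maximality.\<close>
  have ext: "\<exists>m\<in>M. inf m a \<in> I" if "a \<notin> M" for a
  proof (rule ccontr)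
    assume not: "\<not> ?thesis"
    let ?X = "{x. \<exists>m\<in>M. \<exists>e\<in>{a..}. inf m e \<le> x}"
    have "lattice_filter ?X" by (rule lattice_filter_join[OF M(1) lattice_filter_atLeast])
    moreover have "M \<subseteq> ?X" by (auto intro: inf_le1)
    moreover have "?X \<inter> I = {}"
    proof -
      have False if "m \<in> M" "a \<le> e" "inf m e \<le> x" "x \<in> I" for m e x
      proof -
        have "inf m a \<le> x" using that by (meson inf_mono order_refl order_trans)
        then show False using that I not unfolding lattice_ideal_def by blast
      qed
      then show ?thesis by auto
    qed
    moreover have "a \<in> ?X"
    proof -
      have "top \<in> M" "a \<in> {a..}" "inf top a \<le> a" using M(1) by (auto simp: lattice_filter_def)
      then show ?thesis by blast
    qed
    ultimately show False using max[of ?X] M(2) that by blast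
  qed
  have "x \<in> M \<or> y \<in> M" if "sup x y \<in> M" for x y
  proof (rule ccontr)
    assume "\<not> ?thesis"
    then obtain m n where mn: "m \<in> M" "n \<in> M" "inf m x \<in> I" "inf n y \<in> I" using ext by blast
    \<comment> \<open>After distributing, the two joinands are below \<open>inf m x\<close> and
      \<open>inf n y\<close>, so an element of \<open>M\<close> falls into \<open>I\<close>.\<close>
    have "inf (inf m n) (sup x y) \<le> sup (inf m x) (inf n y)"
      unfolding inf_sup_distrib1 by (intro sup_mono inf_mono) auto
    moreover have "sup (inf m x) (inf n y) \<in> I" using mn I by (simp add: lattice_ideal_sup_iff)
    ultimately have "inf (inf m n) (sup x y) \<in> I" using I unfolding lattice_ideal_def by blast
    moreover have "inf (inf m n) (sup x y) \<in> M"
      using mn that M(1) by (simp add: lattice_filter_inf_iff)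
    ultimately show False using M(3) by blast
  qed
  moreover have "bot \<notin> M" using I M(3) by (auto simp: lattice_ideal_def)
  ultimately have "prime_filter M"
    using M(1) by (auto simp: prime_filter_def lattice_filter_def)
  then show thesis using that M by blast
qed

text \<open>The prime filter theorem for the filter generated by \<open>F \<union> E\<close> and the
  ideal generated by \<open>I \<union> J\<close>. In the applications one filter and one ideal come
  from \<open>G\<close>, a further filter or ideal is prescribed, and the remaining slot repeats one
  coming from \<open>G\<close>.\<close>

lemma prime_filter_separation:
  fixes F E I J :: "'d::{bounded_lattice,distrib_lattice} set"
  assumes "lattice_filter F" "lattice_filter E" "lattice_ideal I" "lattice_ideal J"
    and sep: "\<And>f e i j. f \<in> F \<Longrightarrow> e \<in> E \<Longrightarrow> i \<in> I \<Longrightarrow> j \<in> J \<Longrightarrow> \<not> inf f e \<le> sup i j"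
  obtains P where "P \<in> priestley" "F \<subseteq> P" "E \<subseteq> P" "P \<inter> I = {}" "P \<inter> J = {}"
proof -
  let ?F = "{x. \<exists>f\<in>F. \<exists>e\<in>E. inf f e \<le> x}" and ?I = "{x. \<exists>i\<in>I. \<exists>j\<in>J. x \<le> sup i j}"
  have "?F \<inter> ?I = {}" using sep by (blast intro: order_trans)
  with lattice_filter_join[OF assms(1,2)] lattice_ideal_join[OF assms(3,4)]
  obtain P where P: "prime_filter P" "?F \<subseteq> P" "P \<inter> ?I = {}"
    by (rule prime_filter_theorem)
  have "top \<in> F" "top \<in> E" "bot \<in> I" "bot \<in> J"
    using assms(1-4) by (auto simp: lattice_filter_def lattice_ideal_def)
  moreover have "inf x top \<le> x" "inf top x \<le> x" "x \<le> sup x bot" "x \<le> sup bot x" for x :: 'd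
    by auto
  ultimately have "F \<subseteq> ?F" "E \<subseteq> ?F" "I \<subseteq> ?I" "J \<subseteq> ?I" by blast+
  then show thesis using P that[of P] unfolding priestley_def by blast
qed

section \<open>Compactness of Priestley spaces\<close>

lemma priestley_prime [simp]: "P \<in> priestley \<Longrightarrow> prime_filter P"
  by (simp add: priestley_def)

lemma openin_priestley_ppos: "openin priestley_topology (ppos a)"
  and openin_priestley_pneg: "openin priestley_topology (pneg a)"
  unfolding priestley_topology_def by (auto intro: topology_generated_by_Basis)

lemma closedin_priestley_ppos: "closedin priestley_topology (ppos a)"
  and closedin_priestley_pneg: "closedin priestley_topology (pneg a)"
proof -
  have "priestley - ppos a = pneg a" "priestley - pneg a = ppos a"
    by (auto simp: ppos_def pneg_def)
  moreover have "ppos a \<subseteq> priestley" "pneg a \<subseteq> priestley"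
    by (auto simp: ppos_def pneg_def)
  ultimately show "closedin priestley_topology (ppos a)" "closedin priestley_topology (pneg a)"
    by (simp_all add: closedin_def topspace_priestley_topology openin_priestley_ppos
        openin_priestley_pneg)
qed

text \<open>The left side is the form of a subbase that Alexander's theorem expects, the right side
  the one that defines the spaces here.\<close>

lemma topology_generated_by_eq_subbase:
  "topology (arbitrary union_of (finite intersection_of (\<lambda>x. x \<in> S) relative_to \<Union>S))
     = topology_generated_by S"
  (is "topology ?T = _")
proof (rule arg_cong[where f = topology], intro ext iffI)
  fix U
  show "generate_topology_on S U" if "?T U"
  proof -
    have "generate_topology_on S (\<Union>S \<inter> \<Inter>\<F>)" if "finite \<F>" "\<F> \<subseteq> S" for \<F>
      using that
    proof (induction rule: finite_induct)
      case empty
      \<comment> \<open>Relative to \<open>\<Union>S\<close> the empty intersection is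
        \<open>\<Union>S\<close> itself, a union of generators.\<close>
      then show ?case using generate_topology_on.UN[of S S] by (simp add: generate_topology_on.Basis)
    next
      case (insert A \<F>)
      have "\<Union>S \<inter> \<Inter>(insert A \<F>) = A \<inter> (\<Union>S \<inter> \<Inter>\<F>)" by auto
      then show ?case using insert by (simp add: generate_topology_on.Basis generate_topology_on.Int)
    qed
    then show ?thesis
      using that unfolding union_of_def relative_to_def intersection_of_def
      by (auto simp: subset_iff intro!: generate_topology_on.UN)
  qed
  show "?T U" if "generate_topology_on S U"
  proof (rule generate_topology_on_coarsest[OF istopology_subbase _ that])
    fix A assume "A \<in> S"
    then have "(finite intersection_of (\<lambda>x. x \<in> S)) A"
      by (simp add: finite_intersection_of_inc)
    moreover have "\<Union>S \<inter> A = A" using \<open>A \<in> S\<close> by auto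
    ultimately show "?T A"
      by (metis arbitrary_union_of_inc relative_to_inc)
  qed
qed

text \<open>By Alexander's theorem only covers by sets \<open>ppos a\<close> and
  \<open>pneg b\<close> matter. Without a finite subcover, the filter generated by the
  \<open>b\<close> is disjoint from the ideal generated by the \<open>a\<close>, and a prime filter
  separating them is not covered.\<close>

lemma compact_space_priestley: "compact_space priestley_topology"
proof -
  let ?S = "range ppos \<union> range pneg :: 'a set set set"
  have US: "\<Union>?S = (priestley :: 'a set set)" by (auto simp: ppos_def pneg_def)
  have fin: "\<exists>\<D>. finite \<D> \<and> \<D> \<subseteq> \<C> \<and> (priestley :: 'a set set) \<subseteq> \<Union>\<D>"
    if \<C>: "\<C> \<subseteq> ?S" and cov: "priestley \<subseteq> \<Union>\<C>" for \<C>
  proof (rule ccontr)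
    assume not: "\<not> ?thesis"
    define A where "A = {a. ppos a \<in> \<C>}"
    define B where "B = {b. pneg b \<in> \<C>}"
    \<comment> \<open>The generated filter and ideal, described through prime filters so that a common
      element directly yields a finite subcover.\<close>
    define F where "F = {x. \<exists>S\<subseteq>B. finite S \<and> (\<forall>P\<in>priestley. S \<subseteq> P \<longrightarrow> x \<in> P)}"
    define I where "I = {x. \<exists>S\<subseteq>A. finite S \<and> (\<forall>P\<in>priestley. x \<in> P \<longrightarrow> P \<inter> S \<noteq> {})}"
    have mono: "\<forall>P\<in>priestley. x \<in> P \<longrightarrow> y \<in> P" if "x \<le> y" for x y :: 'a
      using that prime_filter_mono priestley_prime by metis
    have "lattice_filter F"
      unfolding lattice_filter_def
    proof (intro conjI allI impI ballI)
      show "top \<in> F" by (auto simp: F_def prime_filter_top)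
      show "y \<in> F" if "x \<in> F" "x \<le> y" for x y
        using that(1) mono[OF that(2)] unfolding F_def by blast
      fix x y assume "x \<in> F" "y \<in> F"
      then obtain S T where "S \<subseteq> B" "finite S" "\<forall>P\<in>priestley. S \<subseteq> P \<longrightarrow> x \<in> P"
        "T \<subseteq> B" "finite T" "\<forall>P\<in>priestley. T \<subseteq> P \<longrightarrow> y \<in> P"
        unfolding F_def by blast
      then show "inf x y \<in> F"
        unfolding F_def by (auto simp: prime_filter_inf_iff intro!: exI[of _ "S \<union> T"])
    qed
    moreover have "lattice_ideal I"
      unfolding lattice_ideal_def
    proof (intro conjI allI impI ballI)
      show "bot \<in> I" by (auto simp: I_def prime_filter_bot)
      show "x \<in> I" if yI: "y \<in> I" and le: "x \<le> y" for x y
      proof -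
        obtain S where "S \<subseteq> A" "finite S" "\<forall>P\<in>priestley. y \<in> P \<longrightarrow> P \<inter> S \<noteq> {}"
          using yI unfolding I_def by blast
        then show ?thesis
          using mono[OF le] unfolding I_def by (intro CollectI exI[of _ S]) simp
      qed
      fix x y assume xy: "x \<in> I" "y \<in> I"
      obtain S where "S \<subseteq> A" "finite S" "\<forall>P\<in>priestley. x \<in> P \<longrightarrow> P \<inter> S \<noteq> {}"
        using xy(1) unfolding I_def by blast
      moreover obtain T where "T \<subseteq> A" "finite T" "\<forall>P\<in>priestley. y \<in> P \<longrightarrow> P \<inter> T \<noteq> {}"
        using xy(2) unfolding I_def by blast
      ultimately show "sup x y \<in> I"
        unfolding I_def
        by (intro CollectI exI[of _ "S \<union> T"]) (auto simp: prime_filter_sup_iff Int_Un_distrib)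
    qed
    moreover have "F \<inter> I = {}"
    proof -
      have False if xF: "x \<in> F" and xI: "x \<in> I" for x
      proof -
        obtain S where S: "S \<subseteq> B" "finite S" "\<forall>P\<in>priestley. S \<subseteq> P \<longrightarrow> x \<in> P"
          using xF unfolding F_def by blast
        obtain T where T: "T \<subseteq> A" "finite T" "\<forall>P\<in>priestley. x \<in> P \<longrightarrow> P \<inter> T \<noteq> {}"
          using xI unfolding I_def by blast
        \<comment> \<open>These sets form a finite subcover: a prime filter omitting some element of
          \<open>S\<close> lies in a \<open>pneg\<close>, while one containing \<open>S\<close>
          contains \<open>x\<close>, hence meets \<open>T\<close> and lies in a
          \<open>ppos\<close>.\<close>
        have "finite (pneg ` S \<union> ppos ` T)" using S(2) T(2) by simp
        moreover have "pneg ` S \<union> ppos ` T \<subseteq> \<C>"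
          using S(1) T(1) by (auto simp: A_def B_def)
        moreover have "P \<in> \<Union>(pneg ` S \<union> ppos ` T)" if P: "P \<in> priestley" for P
        proof (cases "S \<subseteq> P")
          case True
          then obtain a where "a \<in> P" "a \<in> T" using S(3) T(3) P by blast
          then show ?thesis using P by (auto simp: ppos_def)
        next
          case False
          then show ?thesis using P by (auto simp: pneg_def)
        qed
        ultimately show False using not by (metis subsetI)
      qed
      then show ?thesis by blast
    qed
    ultimately obtain P where P: "prime_filter P" "F \<subseteq> P" "P \<inter> I = {}"
      by (rule prime_filter_theorem)
    have "B \<subseteq> F"
    proof
      show "b \<in> F" if "b \<in> B" for b
        unfolding F_def using that by (intro CollectI exI[of _ "{b}"]) simp
    qed
    moreover have "A \<subseteq> I"
    proof
      show "a \<in> I" if "a \<in> A" for a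
        unfolding I_def using that by (intro CollectI exI[of _ "{a}"]) simp
    qed
    ultimately have AB: "B \<subseteq> P" "P \<inter> A = {}" using P by blast+
    \<comment> \<open>Containing \<open>B\<close> keeps \<open>P\<close> out of every
      \<open>pneg\<close> of the cover, and avoiding \<open>A\<close> keeps it out of every
      \<open>ppos\<close>.\<close>
    have "P \<in> priestley" using P(1) unfolding priestley_def by (rule CollectI)
    then obtain U where "U \<in> \<C>" "P \<in> U" using cov by blast
    then consider a where "a \<in> A" "P \<in> ppos a" | b where "b \<in> B" "P \<in> pneg b"
      using \<C> unfolding A_def B_def by blast
    then show False using AB by cases (auto simp: ppos_def pneg_def)
  qed
  have "compact_space (topology_generated_by ?S)"
  proof (rule Alexander_subbase[OF topology_generated_by_eq_subbase])
    fix \<C> assume \<C>: "\<C> \<subseteq> ?S" "\<Union>\<C> = topspace (topology_generated_by ?S)"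
    have eq: "\<Union>\<C> = priestley"
      using \<C>(2) unfolding topology_generated_by_topspace US .
    from fin[OF \<C>(1) equalityD2[OF eq]]
    obtain \<D> where \<D>: "finite \<D>" "\<D> \<subseteq> \<C>" "priestley \<subseteq> \<Union>\<D>"
      by (elim exE conjE) (rule that)
    have "\<Union>\<D> = priestley"
      using \<D>(3) Union_mono[OF \<D>(2)] unfolding eq by (rule equalityI[rotated])
    with \<D>(1,2) have "\<exists>\<D>. finite \<D> \<and> \<D> \<subseteq> \<C> \<and> \<Union>\<D> = priestley"
      by (intro exI[of _ \<D>] conjI)
    then show "\<exists>\<D>. finite \<D> \<and> \<D> \<subseteq> \<C> \<and> \<Union>\<D> = topspace (topology_generated_by ?S)"
      unfolding topology_generated_by_topspace US .
  qed
  then show ?thesis by (simp only: priestley_topology_def)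
qed

section \<open>Points of the convex set of a prime filter\<close>

text \<open>Every element of the quotient is the class of a term, so induction on terms descends to
  it.\<close>

lemma vlat_induct [case_names box dia bot top inf sup]:
  assumes "\<And>a. P (vbox a)" "\<And>a. P (vdia a)" "P bot" "P top"
    and "\<And>s t. P s \<Longrightarrow> P t \<Longrightarrow> P (inf s t)" "\<And>s t. P s \<Longrightarrow> P t \<Longrightarrow> P (sup s t)"
  shows "P x"
proof (induct x rule: vlat.abs_induct)
  fix t
  show "P (abs_vlat t)"
    by (induction t) (use assms in \<open>simp_all add: vbox.abs_eq vdia.abs_eq bot_vlat.abs_eq
        top_vlat.abs_eq flip: inf_vlat.abs_eq sup_vlat.abs_eq\<close>)
qed

section \<open>The defining relations and their reading in a prime filter\<close>

lemma vdia_bot: "vdia bot = bot"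
  and vdia_sup: "vdia (sup a b) = sup (vdia a) (vdia b)"
  and vbox_top: "vbox top = top"
  and vbox_inf: "vbox (inf a b) = inf (vbox a) (vbox b)"
  and vbox_sup_le: "vbox (sup a b) \<le> sup (vbox a) (vdia b)"
  and vbox_vdia_le: "inf (vbox a) (vdia b) \<le> vdia (inf a b)"
  using vrelations_vbox_vdia unfolding vrelations_def by metis+

lemma vbox_mono: "a \<le> b \<Longrightarrow> vbox a \<le> vbox b"
  by (metis inf.absorb_iff1 vbox_inf)

lemma vdia_mono: "a \<le> b \<Longrightarrow> vdia a \<le> vdia b"
  by (metis sup.absorb_iff2 vdia_sup)

lemma lattice_filter_vbox: "G \<in> priestley \<Longrightarrow> lattice_filter {a. vbox a \<in> G}"
  unfolding lattice_filter_def
  by (auto simp: vbox_top vbox_inf prime_filter_inf_iff prime_filter_top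
      intro: prime_filter_mono[OF _ _ vbox_mono])

lemma lattice_ideal_vdia: "G \<in> priestley \<Longrightarrow> lattice_ideal {a. vdia a \<notin> G}"
  unfolding lattice_ideal_def
  by (auto simp: vdia_bot vdia_sup prime_filter_sup_iff prime_filter_bot
      dest: prime_filter_mono[OF priestley_prime _ vdia_mono])

lemma prime_filter_vbox_sup:
  "prime_filter G \<Longrightarrow> vbox (sup a b) \<in> G \<Longrightarrow> vbox a \<in> G \<or> vdia b \<in> G"
  using prime_filter_mono[OF _ _ vbox_sup_le] by (metis prime_filter_sup_iff)

lemma prime_filter_vdia_inf:
  "prime_filter G \<Longrightarrow> vbox a \<in> G \<Longrightarrow> vdia b \<in> G \<Longrightarrow> vdia (inf a b) \<in> G"
  using prime_filter_mono[OF _ _ vbox_vdia_le] by (metis prime_filter_inf_iff)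

lemma mem_Pi_map_iff:
  assumes "G \<in> priestley"
  shows "x \<in> Pi_map G \<longleftrightarrow>
    x \<in> priestley \<and> (\<forall>a. vbox a \<in> G \<longrightarrow> a \<in> x) \<and> (\<forall>a. vdia a \<notin> G \<longrightarrow> a \<notin> x)"
proof -
  \<comment> \<open>This makes the first family of sets nonempty; an empty one would have
    intersection \<open>UNIV\<close> instead of a subset of \<open>priestley\<close>.\<close>
  have "vbox top \<in> G" using assms by (simp add: vbox_top prime_filter_top)
  then show ?thesis by (auto simp: Pi_map_def ppos_def pneg_def)
qed

text \<open>Separates the filter of boxes together with \<open>E\<close> from the ideal of diamonds
  outside \<open>G\<close>. An overlap \<open>inf f e \<le> sup i j\<close> is impossible:
  \<open>vbox f\<close> and \<open>vdia e\<close> put \<open>vdia (inf f e)\<close> into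
  \<open>G\<close>, hence also \<open>vdia i\<close> or \<open>vdia j\<close>.\<close>

lemma Pi_map_extends_filter:
  assumes G: "G \<in> priestley" and E: "lattice_filter E" and sub: "\<And>e. e \<in> E \<Longrightarrow> vdia e \<in> G"
  obtains y where "y \<in> Pi_map G" "E \<subseteq> y"
proof -
  have "\<not> inf f e \<le> sup i j"
    if "vbox f \<in> G" "e \<in> E" "vdia i \<notin> G" "vdia j \<notin> G" for f e i j
  proof
    assume le: "inf f e \<le> sup i j"
    have "vdia (inf f e) \<in> G" using G that sub by (simp add: prime_filter_vdia_inf)
    then have "vdia (sup i j) \<in> G" using G le vdia_mono prime_filter_mono priestley_prime by metis
    then show False using G that by (simp add: vdia_sup prime_filter_sup_iff)
  qed
  then obtain y where "y \<in> priestley" "{a. vbox a \<in> G} \<subseteq> y" "E \<subseteq> y" "y \<inter> {a. vdia a \<notin> G} = {}"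
    using prime_filter_separation[OF lattice_filter_vbox[OF G] E
        lattice_ideal_vdia[OF G] lattice_ideal_vdia[OF G]]
    by (metis (no_types, lifting) mem_Collect_eq)
  then show thesis using that[of y] by (simp add: mem_Pi_map_iff[OF G]) blast
qed

text \<open>The dual separation. An overlap \<open>inf f e \<le> sup j i\<close> would put
  \<open>vbox (sup j i)\<close> into \<open>G\<close>, and the relation for the box of a join then
  yields \<open>vbox j \<in> G\<close> or \<open>vdia i \<in> G\<close>.\<close>

lemma Pi_map_avoids_ideal:
  assumes G: "G \<in> priestley" and J: "lattice_ideal J" and sub: "\<And>j. j \<in> J \<Longrightarrow> vbox j \<notin> G"
  obtains y where "y \<in> Pi_map G" "y \<inter> J = {}"
proof -
  have "\<not> inf f e \<le> sup j i"
    if "vbox f \<in> G" "vbox e \<in> G" "j \<in> J" "vdia i \<notin> G" for f e i j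
  proof
    assume le: "inf f e \<le> sup j i"
    have "vbox (inf f e) \<in> G" using G that by (simp add: vbox_inf prime_filter_inf_iff)
    then have "vbox (sup j i) \<in> G" using G le vbox_mono prime_filter_mono priestley_prime by metis
    then show False using G that sub prime_filter_vbox_sup priestley_prime by blast
  qed
  then obtain y where "y \<in> priestley" "{a. vbox a \<in> G} \<subseteq> y" "y \<inter> J = {}" "y \<inter> {a. vdia a \<notin> G} = {}"
    using prime_filter_separation[OF lattice_filter_vbox[OF G] lattice_filter_vbox[OF G] J
        lattice_ideal_vdia[OF G]]
    by (metis (no_types, lifting) mem_Collect_eq)
  then show thesis using that[of y] by (simp add: mem_Pi_map_iff[OF G]) blast
qed

text \<open>If \<open>vbox a \<notin> G\<close>, no \<open>vbox j\<close> with
  \<open>j \<le> a\<close> is in \<open>G\<close>, so some point of \<open>Pi_map G\<close> avoids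
  the principal ideal of \<open>a\<close>.\<close>

lemma vbox_mem_iff:
  assumes G: "G \<in> priestley"
  shows "vbox a \<in> G \<longleftrightarrow> (\<forall>x\<in>Pi_map G. a \<in> x)"
proof
  show "\<forall>x\<in>Pi_map G. a \<in> x" if "vbox a \<in> G"
    using G that by (simp add: mem_Pi_map_iff)
  show "vbox a \<in> G" if all: "\<forall>x\<in>Pi_map G. a \<in> x"
  proof (rule ccontr)
    assume "vbox a \<notin> G"
    then have "vbox j \<notin> G" if "j \<in> {..a}" for j
      using G that vbox_mono prime_filter_mono priestley_prime by (metis atMost_iff)
    from Pi_map_avoids_ideal[OF G lattice_ideal_atMost this]
    obtain y where "y \<in> Pi_map G" "y \<inter> {..a} = {}" by blast
    then show False using all by auto
  qed
qed

text \<open>If \<open>vdia a \<in> G\<close>, all diamonds of elements above \<open>a\<close> are in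
  \<open>G\<close>, so some point of \<open>Pi_map G\<close> extends the principal filter of
  \<open>a\<close>.\<close>

lemma vdia_mem_iff:
  assumes G: "G \<in> priestley"
  shows "vdia a \<in> G \<longleftrightarrow> (\<exists>x\<in>Pi_map G. a \<in> x)"
proof
  show "vdia a \<in> G" if "\<exists>x\<in>Pi_map G. a \<in> x"
    using G that by (auto simp: mem_Pi_map_iff)
  assume "vdia a \<in> G"
  then have "vdia e \<in> G" if "e \<in> {a..}" for e
    using G that vdia_mono prime_filter_mono priestley_prime by (metis atLeast_iff)
  from Pi_map_extends_filter[OF G lattice_filter_atLeast this]
  obtain y where "y \<in> Pi_map G" "{a..} \<subseteq> y" by blast
  then show "\<exists>x\<in>Pi_map G. a \<in> x" by auto
qed

lemma Pi_map_convex_closed: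
  assumes G: "G \<in> priestley"
  shows "Pi_map G \<in> convex_closed"
proof -
  \<comment> \<open>Both families of closed sets are therefore nonempty, as
    \<open>closedin_Inter\<close> demands.\<close>
  have "vbox top \<in> G" "vdia bot \<notin> G"
    using G by (simp_all add: vbox_top vdia_bot prime_filter_top prime_filter_bot)
  then have "closedin priestley_topology (Pi_map G)"
    unfolding Pi_map_def
    by (intro closedin_Int closedin_Inter) (auto simp: closedin_priestley_ppos closedin_priestley_pneg)
  then show ?thesis
    using G by (auto simp: convex_closed_def mem_Pi_map_iff subset_iff)
qed

section \<open>Inclusion of prime filters and the Egli-Milner order\<close>

lemma priestley_vlat_subset_iff:
  assumes G: "G \<in> priestley" and H: "H \<in> priestley"
  shows "G \<subseteq> H \<longleftrightarrow>
    (\<forall>a. vbox a \<in> G \<longrightarrow> vbox a \<in> H) \<and> (\<forall>a. vdia a \<in> G \<longrightarrow> vdia a \<in> H)"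
proof
  assume gen: "(\<forall>a. vbox a \<in> G \<longrightarrow> vbox a \<in> H) \<and> (\<forall>a. vdia a \<in> G \<longrightarrow> vdia a \<in> H)"
  \<comment> \<open>Prime filters turn meets into conjunctions and joins into disjunctions, both
    monotone, so the implication spreads from the generators to all elements.\<close>
  have "t \<in> G \<longrightarrow> t \<in> H" for t
    by (induction t rule: vlat_induct)
      (use gen G H in \<open>auto simp: prime_filter_inf_iff prime_filter_sup_iff prime_filter_bot
        prime_filter_top\<close>)
  then show "G \<subseteq> H" by blast
qed blast

text \<open>From left to right, a point of \<open>Pi_map G\<close> is itself the filter to extend
  inside \<open>Pi_map H\<close>, and the complement of a point of \<open>Pi_map H\<close> is the
  ideal to avoid inside \<open>Pi_map G\<close>. The converse is checked on generators: upper bounds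
  transport diamonds, lower bounds transport boxes.\<close>

lemma Pi_map_egli_milner:
  assumes G: "G \<in> priestley" and H: "H \<in> priestley"
  shows "G \<subseteq> H \<longleftrightarrow> egli_milner (Pi_map G) (Pi_map H)"
proof
  assume sub: "G \<subseteq> H"
  have "x \<in> down_closure (Pi_map H)" if x: "x \<in> Pi_map G" for x
  proof -
    have xp: "x \<in> priestley" using x G by (simp add: mem_Pi_map_iff)
    have "vdia e \<in> H" if "e \<in> x" for e
      using that x sub vdia_mem_iff[OF G] by blast
    with Pi_map_extends_filter[OF H prime_filter_imp_filter[OF priestley_prime[OF xp]]]
    obtain y where "y \<in> Pi_map H" "x \<subseteq> y" by blast
    then show ?thesis using xp by (auto simp: down_closure_def)
  qed
  moreover have "y \<in> up_closure (Pi_map G)" if y: "y \<in> Pi_map H" for y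
  proof -
    have yp: "y \<in> priestley" using y H by (simp add: mem_Pi_map_iff)
    \<comment> \<open>The point \<open>y\<close> lacks \<open>j\<close>, so \<open>vbox j\<close> is
      not in \<open>H\<close> and hence not in the smaller set \<open>G\<close>.\<close>
    have "vbox j \<notin> G" if "j \<in> - y" for j
      using that y sub vbox_mem_iff[OF H] by blast
    with Pi_map_avoids_ideal[OF G prime_filter_imp_ideal[OF priestley_prime[OF yp]]]
    obtain x where "x \<in> Pi_map G" "x \<inter> - y = {}" by blast
    then show ?thesis using yp by (auto simp: up_closure_def)
  qed
  ultimately show "egli_milner (Pi_map G) (Pi_map H)" by (auto simp: egli_milner_def)
next
  assume "egli_milner (Pi_map G) (Pi_map H)"
  then have down: "\<forall>x\<in>Pi_map G. \<exists>y\<in>Pi_map H. x \<subseteq> y"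
    and up: "\<forall>y\<in>Pi_map H. \<exists>x\<in>Pi_map G. x \<subseteq> y"
    by (auto simp: egli_milner_def down_closure_def up_closure_def)
  have "vbox a \<in> H" if "vbox a \<in> G" for a
    using that up unfolding vbox_mem_iff[OF G] vbox_mem_iff[OF H] by (meson subsetD)
  moreover have "vdia a \<in> H" if "vdia a \<in> G" for a
    using that down unfolding vdia_mem_iff[OF G] vdia_mem_iff[OF H] by (meson subsetD)
  ultimately show "G \<subseteq> H"
    by (simp add: priestley_vlat_subset_iff[OF G H])
qed

text \<open>An order embedding is injective: \<open>G \<subseteq> G\<close> shows that the
  Egli-Milner order is reflexive at the common image, and this reflects to inclusions both
  ways.\<close>

lemma inj_on_Pi_map: "inj_on Pi_map priestley"
proof (rule inj_onI)
  fix G H :: "'a vlat set"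
  assume GH: "G \<in> priestley" "H \<in> priestley" "Pi_map G = Pi_map H"
  have "egli_milner (Pi_map G) (Pi_map G)"
    using Pi_map_egli_milner[OF GH(1,1)] by simp
  then show "G = H"
    using GH Pi_map_egli_milner by (metis subset_antisym)
qed

section \<open>Surjectivity and homeomorphism\<close>

text \<open>The witness is the join of \<open>S\<close>, with \<open>bot\<close> for the empty set.
  Below it condenses a finite subcover by sets \<open>ppos\<close> into one element.\<close>

lemma priestley_finite_sup:
  fixes S :: "'d::{bounded_lattice,distrib_lattice} set"
  assumes "finite S"
  shows "\<exists>a. \<forall>P\<in>priestley. a \<in> P \<longleftrightarrow> P \<inter> S \<noteq> {}"
  using assms
proof (induction rule: finite_induct)
  case empty
  then show ?case by (auto simp: prime_filter_bot intro: exI[of _ bot])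
next
  case (insert s S)
  then obtain a where "\<forall>P\<in>priestley. a \<in> P \<longleftrightarrow> P \<inter> S \<noteq> {}" by blast
  then have "\<forall>P\<in>priestley. sup s a \<in> P \<longleftrightarrow> P \<inter> insert s S \<noteq> {}"
    by (auto simp: prime_filter_sup_iff)
  then show ?case ..
qed

lemma priestley_finite_inf:
  fixes S :: "'d::{bounded_lattice,distrib_lattice} set"
  assumes "finite S"
  shows "\<exists>a. \<forall>P\<in>priestley. a \<in> P \<longleftrightarrow> S \<subseteq> P"
  using assms
proof (induction rule: finite_induct)
  case empty
  then show ?case by (auto simp: prime_filter_top intro: exI[of _ top])
next
  case (insert s S)
  then obtain a where "\<forall>P\<in>priestley. a \<in> P \<longleftrightarrow> S \<subseteq> P" by blast
  then have "\<forall>P\<in>priestley. inf s a \<in> P \<longleftrightarrow> insert s S \<subseteq> P"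
    by (auto simp: prime_filter_inf_iff)
  then show ?case ..
qed

text \<open>If no point of \<open>C\<close> is below \<open>x\<close>, each one contains some
  element outside \<open>x\<close>, so the sets \<open>ppos a\<close> with
  \<open>a \<notin> x\<close> cover \<open>C\<close>. The join for a finite subcover belongs to
  every point of \<open>C\<close>, hence to \<open>x\<close>, although none of the joined elements
  does.\<close>

lemma compactin_obtains_below:
  assumes C: "compactin priestley_topology C" and x: "x \<in> priestley"
    and sub: "\<And>a. \<forall>y\<in>C. a \<in> y \<Longrightarrow> a \<in> x"
  obtains y where "y \<in> C" "y \<subseteq> x"
proof (rule ccontr)
  assume not: "\<not> thesis"
  have Cp: "C \<subseteq> priestley"
    using compactin_subset_topspace[OF C] by (simp add: topspace_priestley_topology)
  have "C \<subseteq> \<Union>(ppos ` (- x))" using not that Cp by (fastforce simp: ppos_def)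
  then obtain S where S: "finite S" "S \<subseteq> - x" "C \<subseteq> \<Union>(ppos ` S)"
    using compactinD[OF C, of "ppos ` (- x)"] openin_priestley_ppos
    by (metis finite_subset_image imageE)
  obtain a where a: "\<forall>P\<in>priestley. a \<in> P \<longleftrightarrow> P \<inter> S \<noteq> {}"
    using priestley_finite_sup[OF S(1)] by blast
  have "\<forall>y\<in>C. a \<in> y" using a Cp S(3) by (fastforce simp: ppos_def)
  then have "a \<in> x" by (rule sub)
  then show False using a x S(2) by blast
qed

text \<open>The order dual: the sets \<open>pneg a\<close> with \<open>a \<in> x\<close> would cover
  \<open>C\<close>, and the meet for a finite subcover lies in \<open>x\<close> but in no point of
  \<open>C\<close>.\<close>

lemma compactin_obtains_above:
  assumes C: "compactin priestley_topology C" and x: "x \<in> priestley"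
    and sub: "\<And>a. \<forall>y\<in>C. a \<notin> y \<Longrightarrow> a \<notin> x"
  obtains y where "y \<in> C" "x \<subseteq> y"
proof (rule ccontr)
  assume not: "\<not> thesis"
  have Cp: "C \<subseteq> priestley"
    using compactin_subset_topspace[OF C] by (simp add: topspace_priestley_topology)
  have "C \<subseteq> \<Union>(pneg ` x)" using not that Cp by (fastforce simp: pneg_def)
  then obtain S where S: "finite S" "S \<subseteq> x" "C \<subseteq> \<Union>(pneg ` S)"
    using compactinD[OF C, of "pneg ` x"] openin_priestley_pneg
    by (metis finite_subset_image imageE)
  obtain a where a: "\<forall>P\<in>priestley. a \<in> P \<longleftrightarrow> S \<subseteq> P"
    using priestley_finite_inf[OF S(1)] by blast
  have "\<forall>y\<in>C. a \<notin> y" using a Cp S(3) by (fastforce simp: pneg_def)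
  then have "a \<notin> x" by (rule sub)
  then show False using a x S(2) by blast
qed

lemma Pi_map_surj:
  fixes C :: "'a::{bounded_lattice,distrib_lattice} set set"
  assumes C: "C \<in> convex_closed"
  obtains G where "G \<in> priestley" "Pi_map G = C"
proof -
  have comp: "compactin priestley_topology C"
    using C compact_space_priestley by (auto simp: convex_closed_def intro: closedin_compact_space)
  then have Cp: "C \<subseteq> priestley"
    using compactin_subset_topspace topspace_priestley_topology by blast
  \<comment> \<open>The target lattice is \<open>bool\<close>, where the order is implication; each
    relation follows from primality of the points of \<open>C\<close>.\<close>
  have "vrelations (\<lambda>a. \<forall>y\<in>C. a \<in> y) (\<lambda>a. \<exists>y\<in>C. a \<in> y)"
    using Cp unfolding vrelations_def
    by (auto simp: subset_iff prime_filter_bot prime_filter_top prime_filter_sup_iff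
        prime_filter_inf_iff)
  from ex1_implies_ex[OF vlat_universal[OF this]]
  obtain h :: "'a vlat \<Rightarrow> bool" where hom: "lattice_hom h"
    and gen: "\<forall>a. h (vbox a) \<longleftrightarrow> (\<forall>y\<in>C. a \<in> y)" "\<forall>a. h (vdia a) \<longleftrightarrow> (\<exists>y\<in>C. a \<in> y)"
    by (elim exE conjE) (rule that)
  note h = hom gen[rule_format]
  define G where "G = Collect h"
  \<comment> \<open>A homomorphism to \<open>bool\<close> is monotone, so the elements it sends to
    \<open>True\<close> form an up-set; the other prime filter conditions are the homomorphism
    equations.\<close>
  have "h y" if "h x" "x \<le> y" for x y
    using that h(1) unfolding lattice_hom_def by (metis inf.absorb_iff1 inf_bool_def)
  then have G: "G \<in> priestley"
    using h(1) by (auto simp: G_def priestley_def prime_filter_def lattice_hom_def)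
  moreover have "Pi_map G = C"
  proof (intro set_eqI iffI)
    fix x assume "x \<in> C"
    then show "x \<in> Pi_map G" using Cp G h by (auto simp: mem_Pi_map_iff G_def)
  next
    fix x assume "x \<in> Pi_map G"
    then have xp: "x \<in> priestley" and pos: "\<And>a. \<forall>y\<in>C. a \<in> y \<Longrightarrow> a \<in> x"
      and neg: "\<And>a. \<forall>y\<in>C. a \<notin> y \<Longrightarrow> a \<notin> x"
      using G h by (auto simp: mem_Pi_map_iff G_def)
    \<comment> \<open>Together with the point above \<open>x\<close> obtained next, this sandwiches
      \<open>x\<close> in \<open>C\<close>, and convexity applies.\<close>
    obtain y where "y \<in> C" "y \<subseteq> x" using compactin_obtains_below[OF comp xp pos] by blast
    moreover obtain z where "z \<in> C" "x \<subseteq> z" using compactin_obtains_above[OF comp xp neg] by blast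
    ultimately show "x \<in> C" using C xp unfolding convex_closed_def by blast
  qed
  ultimately show thesis by (rule that)
qed

section \<open>Images of the subbasic sets\<close>

lemma Pi_map_image: "Pi_map ` priestley = convex_closed"
  using Pi_map_convex_closed by (auto elim: Pi_map_surj)

text \<open>Membership of a generator in \<open>G\<close> is a property of \<open>Pi_map G\<close>
  alone, and by surjectivity the image of the prime filters with that property is the set of all
  convex closed sets with it.\<close>

lemma Pi_map_image_generators:
  fixes a :: "'a::{bounded_lattice,distrib_lattice}"
  shows "Pi_map ` ppos (vbox a) = miss (pneg a)" "Pi_map ` pneg (vbox a) = hit (pneg a)"
  "Pi_map ` ppos (vdia a) = hit (ppos a)" "Pi_map ` pneg (vdia a) = miss (ppos a)"
proof -
  have image: "Pi_map ` {G \<in> priestley. Q (Pi_map G)} = {C \<in> convex_closed. Q C}"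
    for Q :: "'a set set \<Rightarrow> bool"
    unfolding Pi_map_image[symmetric] by blast
  have sub: "C \<subseteq> priestley" if "C \<in> convex_closed" for C :: "'a set set"
    using that closedin_subset
    by (fastforce simp: convex_closed_def topspace_priestley_topology)
  have "ppos (vbox a) = {G \<in> priestley. \<forall>x\<in>Pi_map G. a \<in> x}"
    "pneg (vbox a) = {G \<in> priestley. \<not> (\<forall>x\<in>Pi_map G. a \<in> x)}"
    "ppos (vdia a) = {G \<in> priestley. \<exists>x\<in>Pi_map G. a \<in> x}"
    "pneg (vdia a) = {G \<in> priestley. \<not> (\<exists>x\<in>Pi_map G. a \<in> x)}"
    by (auto simp: ppos_def pneg_def vbox_mem_iff vdia_mem_iff)
  moreover have
    "miss (pneg a) = {C \<in> convex_closed. \<forall>x\<in>C. a \<in> x}"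
    "hit (pneg a) = {C \<in> convex_closed. \<not> (\<forall>x\<in>C. a \<in> x)}"
    "hit (ppos a) = {C \<in> convex_closed. \<exists>x\<in>C. a \<in> x}"
    "miss (ppos a) = {C \<in> convex_closed. \<not> (\<exists>x\<in>C. a \<in> x)}"
    using sub unfolding hit_def miss_def ppos_def pneg_def by blast+
  ultimately show "Pi_map ` ppos (vbox a) = miss (pneg a)" "Pi_map ` pneg (vbox a) = hit (pneg a)"
    "Pi_map ` ppos (vdia a) = hit (ppos a)" "Pi_map ` pneg (vdia a) = miss (ppos a)"
    using image[of "\<lambda>C. \<forall>x\<in>C. a \<in> x"] image[of "\<lambda>C. \<not> (\<forall>x\<in>C. a \<in> x)"]
      image[of "\<lambda>C. \<exists>x\<in>C. a \<in> x"] image[of "\<lambda>C. \<not> (\<exists>x\<in>C. a \<in> x)"]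
    by simp_all
qed

section \<open>Openness of images and the homeomorphism\<close>

lemma openin_hit_or_miss:
  "openin hit_or_miss_topology (miss (ppos a))" "openin hit_or_miss_topology (miss (pneg a))"
  "openin hit_or_miss_topology (hit (ppos a))" "openin hit_or_miss_topology (hit (pneg a))"
  unfolding hit_or_miss_topology_def by (auto intro: topology_generated_by_Basis)

lemma openin_Pi_map_image:
  "openin hit_or_miss_topology (Pi_map ` ppos t) \<and> openin hit_or_miss_topology (Pi_map ` pneg t)"
proof (induction t rule: vlat_induct)
  case (box a)
  then show ?case by (simp add: Pi_map_image_generators openin_hit_or_miss)
next
  case (dia a)
  then show ?case by (simp add: Pi_map_image_generators openin_hit_or_miss)
next
  case bot
  have "ppos bot = ({} :: 'a vlat set set)" "pneg bot = (priestley :: 'a vlat set set)"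
    by (auto simp: ppos_def pneg_def prime_filter_bot)
  then show ?case
    by (metis Pi_map_image image_empty openin_empty openin_topspace topspace_hit_or_miss_topology)
next
  case top
  have "pneg top = ({} :: 'a vlat set set)" "ppos top = (priestley :: 'a vlat set set)"
    by (auto simp: ppos_def pneg_def prime_filter_top)
  then show ?case
    by (metis Pi_map_image image_empty openin_empty openin_topspace topspace_hit_or_miss_topology)
next
  case (inf s t)
  have "ppos (inf s t) = ppos s \<inter> ppos t" "pneg (inf s t) = pneg s \<union> pneg t"
    by (auto simp: ppos_def pneg_def prime_filter_inf_iff)
  \<comment> \<open>Images commute with intersections here by injectivity.\<close>
  moreover have "Pi_map ` (ppos s \<inter> ppos t) = Pi_map ` ppos s \<inter> Pi_map ` ppos t"
    by (rule inj_on_image_Int[OF inj_on_Pi_map]) (auto simp: ppos_def)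
  ultimately show ?case using inf by (simp add: image_Un openin_Int openin_Un)
next
  case (sup s t)
  have "ppos (sup s t) = ppos s \<union> ppos t" "pneg (sup s t) = pneg s \<inter> pneg t"
    by (auto simp: ppos_def pneg_def prime_filter_sup_iff)
  moreover have "Pi_map ` (pneg s \<inter> pneg t) = Pi_map ` pneg s \<inter> Pi_map ` pneg t"
    by (rule inj_on_image_Int[OF inj_on_Pi_map]) (auto simp: pneg_def)
  ultimately show ?case using sup by (simp add: image_Un openin_Int openin_Un)
qed

text \<open>The condition on \<open>S\<close> makes the inverse continuous, the condition on
  \<open>T\<close> makes \<open>f\<close> continuous; by bijectivity both need testing only on the
  generators.\<close>

lemma homeomorphic_map_generated:
  assumes bij: "bij_betw f (\<Union>S) (\<Union>T)"
    and S: "\<And>U. U \<in> S \<Longrightarrow> openin (topology_generated_by T) (f ` U)"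
    and T: "\<And>V. V \<in> T \<Longrightarrow> \<exists>U. openin (topology_generated_by S) U \<and> f ` U = V"
  shows "homeomorphic_map (topology_generated_by S) (topology_generated_by T) f"
proof -
  define g where "g = inv_into (\<Union>S) f"
  have inj: "inj_on f (\<Union>S)" and img: "f ` \<Union>S = \<Union>T"
    using bij by (auto simp: bij_betw_def)
  have gf: "g (f x) = x" if "x \<in> \<Union>S" for x
    using that inj by (simp only: g_def inv_into_f_f)
  have fg: "f (g y) = y" and g: "g y \<in> \<Union>S" if "y \<in> \<Union>T" for y
    using that img unfolding g_def by (metis f_inv_into_f, metis inv_into_into)
  have "continuous_map (topology_generated_by S) (topology_generated_by T) f"
  proof (rule continuous_on_generated_topo)
    fix V assume "V \<in> T"
    then obtain U where U: "openin (topology_generated_by S) U" "f ` U = V" using T by blast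
    then have "U \<subseteq> \<Union>S" using openin_subset by fastforce
    \<comment> \<open>Injectivity ensures that no point outside \<open>U\<close> is mapped into
      \<open>V\<close>.\<close>
    then have "f -` V \<inter> \<Union>S = U" using U(2) inj_on_image_mem_iff[OF inj] by blast
    then show "openin (topology_generated_by S) (f -` V \<inter> topspace (topology_generated_by S))"
      using U(1) by simp
  qed (simp add: img)
  moreover have "continuous_map (topology_generated_by T) (topology_generated_by S) g"
  proof (rule continuous_on_generated_topo)
    fix U assume U: "U \<in> S"
    have "y \<in> g -` U \<inter> \<Union>T \<longleftrightarrow> y \<in> f ` U" for y
    proof
      show "y \<in> f ` U" if "y \<in> g -` U \<inter> \<Union>T"
        using that fg[of y] by (metis IntE image_eqI vimageE)
      assume "y \<in> f ` U"
      then obtain x where "x \<in> U" "y = f x" by blast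
      moreover from this U have "x \<in> \<Union>S" by blast
      ultimately show "y \<in> g -` U \<inter> \<Union>T" using gf[of x] img by auto
    qed
    then have "g -` U \<inter> \<Union>T = f ` U" by (rule set_eqI)
    then show "openin (topology_generated_by T) (g -` U \<inter> topspace (topology_generated_by T))"
      using S[OF U] by simp
  qed (use g in auto)
  ultimately show ?thesis
    unfolding homeomorphic_map_maps homeomorphic_maps_def
    by (intro exI[of _ g]) (use gf fg in auto)
qed

lemma homeomorphic_map_Pi_map:
  "homeomorphic_map priestley_topology hit_or_miss_topology Pi_map"
proof -
  let ?S = "range ppos \<union> range pneg :: 'a vlat set set set"
  let ?T = "range (\<lambda>a::'a. miss (ppos a)) \<union> range (\<lambda>a. miss (pneg a)) \<union>
      range (\<lambda>a. hit (ppos a)) \<union> range (\<lambda>a. hit (pneg a))"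
  have "\<Union>?S = topspace priestley_topology" "\<Union>?T = topspace hit_or_miss_topology"
    by (simp_all add: priestley_topology_def hit_or_miss_topology_def)
  then have "bij_betw Pi_map (\<Union>?S) (\<Union>?T)"
    unfolding topspace_priestley_topology topspace_hit_or_miss_topology
    using inj_on_Pi_map Pi_map_image by (simp only: bij_betw_def)
  then show ?thesis
    unfolding priestley_topology_def hit_or_miss_topology_def
  proof (rule homeomorphic_map_generated, fold priestley_topology_def hit_or_miss_topology_def)
    show "openin hit_or_miss_topology (Pi_map ` U)" if "U \<in> ?S" for U
      using that openin_Pi_map_image by blast
    show "\<exists>U. openin priestley_topology U \<and> Pi_map ` U = V" if "V \<in> ?T" for V
    proof -
      \<comment> \<open>The four image formulas, read backwards, present each generator as the image
        of a subbasic set of a box or a diamond.\<close>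
      have "V \<in> (`) Pi_map ` ?S"
        using that unfolding Pi_map_image_generators[symmetric] by blast
      then show ?thesis
        using openin_priestley_ppos openin_priestley_pneg by (elim imageE) blast
    qed
  qed
qed

theorem theorem4p17:
  shows "(Pi_map :: 'a::{bounded_lattice,distrib_lattice} vlat set \<Rightarrow> 'a set set)
           \<in> priestley \<rightarrow> convex_closed
    \<and> homeomorphic_map priestley_topology hit_or_miss_topology
         (Pi_map :: 'a vlat set \<Rightarrow> 'a set set)
    \<and> (\<forall>G\<in>priestley. \<forall>H\<in>priestley.
         G \<subseteq> H \<longleftrightarrow> egli_milner (Pi_map G :: 'a set set) (Pi_map H))
    \<and> (\<forall>a::'a.
         Pi_map ` ppos (vbox a) = miss (pneg a)
       \<and> Pi_map ` pneg (vbox a) = hit (pneg a)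
       \<and> Pi_map ` ppos (vdia a) = hit (ppos a)
       \<and> Pi_map ` pneg (vdia a) = miss (ppos a))"
  by (intro conjI ballI allI Pi_I Pi_map_convex_closed homeomorphic_map_Pi_map
      Pi_map_egli_milner Pi_map_image_generators)

end
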